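(* Let $G$ be a finite nonabelian simple group, $M$ a maximal subgroup of $G$ and $g\in M\setminus\{1\}$. Let $\mathcal{V}:=\{M^x : x\in G \text{ such that } g\in M^x\}$, $A:=\bigcap_{Q\in\mathcal{V}} Q$ and $S:=N_G(A)$. Then $C_G(g)\leq S$ and $g^S=A\cap g^G$.
   Context: For $x\in G$ and a subgroup $M$ of $G$, $M^x=x^{-1}Mx$. For a subgroup $H\le G$ and $g\in G$, $g^H=\{h^{-1}gh : h\in H\}$; in particular $g^G$ is the conjugacy class of $g$ in $G$. $N_G(A)$ is the normalizer of $A$ in $G$ and $C_G(g)$ is the centralizer of $g$ in $G$. *)

theory Defs
  imports "HOL-Algebra.Algebra"
begin

definition maximal_subgroup :: "'a set \<Rightarrow> ('a, 'b) monoid_scheme \<Rightarrow> bool" where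
  "maximal_subgroup M G \<longleftrightarrow>
     subgroup M G \<and> M \<noteq> carrier G \<and>
     (\<forall>H. subgroup H G \<and> M \<subseteq> H \<longrightarrow> H = M \<or> H = carrier G)"

(* Conjugation is a right action, with the inverse on the left, whereas the library's
   normalizer uses the left action; the two notions of normalizer coincide. *)

definition conj_subgroup :: "('a, 'b) monoid_scheme \<Rightarrow> 'a set \<Rightarrow> 'a \<Rightarrow> 'a set" where
  "conj_subgroup G M x = inv\<^bsub>G\<^esub> x <#\<^bsub>G\<^esub> M #>\<^bsub>G\<^esub> x"

(* g^H; taking H = carrier G gives the conjugacy class of g in G. *)
definition conj_class :: "('a, 'b) monoid_scheme \<Rightarrow> 'a set \<Rightarrow> 'a \<Rightarrow> 'a set" where
  "conj_class G H g = {inv\<^bsub>G\<^esub> h \<otimes>\<^bsub>G\<^esub> g \<otimes>\<^bsub>G\<^esub> h | h. h \<in> H}"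

definition centralizer :: "('a, 'b) monoid_scheme \<Rightarrow> 'a \<Rightarrow> 'a set" where
  "centralizer G g = {x \<in> carrier G. x \<otimes>\<^bsub>G\<^esub> g = g \<otimes>\<^bsub>G\<^esub> x}"

end

theory Submission
  imports Defs
begin

text \<open>Conjugating by \<open>h\<close> carries the set of conjugates of \<open>M\<close> through \<open>g\<close> onto the set of those
  through \<open>inv h \<otimes> g \<otimes> h\<close> (\<open>conj_image_conjugates_through\<close>). If the element
  \<open>inv h \<otimes> g \<otimes> h\<close> lies in \<open>A\<close>, then every member of the first set passes through it, so the
  first set is contained in the second. The second is an image of the first, which is finite, so
  the two sets coincide; conjugation by \<open>h\<close> then permutes the conjugates of \<open>M\<close> through \<open>g\<close> and
  fixes their intersection \<open>A\<close>, that is, \<open>h\<close> normalizes \<open>A\<close>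
  (\<open>normalizes_Inter_conjugates_through\<close>).

  Both claims follow. An element centralizing \<open>g\<close> conjugates \<open>g\<close> to \<open>g\<close> itself, which lies in
  \<open>A\<close>; and whenever \<open>h\<close> conjugates \<open>g\<close> into \<open>A\<close>, it is already an element of \<open>S\<close>. Conversely,
  \<open>S\<close> conjugates \<open>g \<in> A\<close> into \<open>A\<close> because it normalizes \<open>A\<close>.\<close>

context group
begin

lemma mult_inv_cancel_left:
  assumes "x \<in> carrier G" "y \<in> carrier G"
  shows "x \<otimes> (inv x \<otimes> y) = y" "inv x \<otimes> (x \<otimes> y) = y"
  using assms by (simp_all flip: m_assoc)

lemma mem_conj_subgroup_iff:
  assumes "M \<subseteq> carrier G" "x \<in> carrier G" "y \<in> carrier G"
  shows "y \<in> conj_subgroup G M x \<longleftrightarrow> x \<otimes> y \<otimes> inv x \<in> M"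
proof
  assume "y \<in> conj_subgroup G M x"
  then obtain m where "m \<in> M" "y = inv x \<otimes> m \<otimes> x"
    by (auto simp: conj_subgroup_def l_coset_def r_coset_def)
  moreover have "x \<otimes> (inv x \<otimes> m \<otimes> x) \<otimes> inv x = m"
    using assms \<open>m \<in> M\<close> by (simp add: m_assoc subset_iff mult_inv_cancel_left)
  ultimately show "x \<otimes> y \<otimes> inv x \<in> M" by simp
next
  assume *: "x \<otimes> y \<otimes> inv x \<in> M"
  have "y = inv x \<otimes> (x \<otimes> y \<otimes> inv x) \<otimes> x"
    using assms by (simp add: m_assoc mult_inv_cancel_left)
  with * show "y \<in> conj_subgroup G M x"
    by (auto simp: conj_subgroup_def l_coset_def r_coset_def)
qed

lemma conj_subgroup_subset_carrier:
  "M \<subseteq> carrier G \<Longrightarrow> x \<in> carrier G \<Longrightarrow> conj_subgroup G M x \<subseteq> carrier G"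
  by (simp add: conj_subgroup_def l_coset_subset_G r_coset_subset_G)

lemma conj_subgroup_eq_Collect:
  assumes "M \<subseteq> carrier G" "x \<in> carrier G"
  shows "conj_subgroup G M x = {y \<in> carrier G. x \<otimes> y \<otimes> inv x \<in> M}"
  using assms mem_conj_subgroup_iff conj_subgroup_subset_carrier by blast

lemma conj_subgroup_one: "M \<subseteq> carrier G \<Longrightarrow> conj_subgroup G M \<one> = M"
  by (auto simp: conj_subgroup_eq_Collect)

lemma conj_subgroup_conj_subgroup:
  assumes "M \<subseteq> carrier G" "x \<in> carrier G" "y \<in> carrier G"
  shows "conj_subgroup G (conj_subgroup G M x) y = conj_subgroup G M (x \<otimes> y)"
  using assms
  by (auto simp: conj_subgroup_eq_Collect conj_subgroup_subset_carrier m_assoc inv_mult_group)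

lemma conj_subgroup_Inter:
  assumes "\<And>Q. Q \<in> W \<Longrightarrow> Q \<subseteq> carrier G" "W \<noteq> {}" "h \<in> carrier G"
  shows "conj_subgroup G (\<Inter>W) h = \<Inter>((\<lambda>Q. conj_subgroup G Q h) ` W)"
proof -
  have "\<Inter>W \<subseteq> carrier G" using assms by blast
  then show ?thesis
    using assms by (auto simp: conj_subgroup_eq_Collect)
qed

text \<open>The library's normalizer acts by \<open>h <# A #> inv h\<close>, which is conjugation by \<open>inv h\<close> in the
  right-action convention; fixing \<open>A\<close> is the same condition for \<open>h\<close> and \<open>inv h\<close>.\<close>

lemma mem_normalizer_iff_conj_subgroup:
  assumes "A \<subseteq> carrier G" "h \<in> carrier G"
  shows "h \<in> normalizer G A \<longleftrightarrow> conj_subgroup G A h = A"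
proof -
  have left: "h <# A #> inv h = conj_subgroup G A (inv h)"
    using assms by (simp add: conj_subgroup_def)
  have "conj_subgroup G A (inv h) = A \<longleftrightarrow> conj_subgroup G A h = A"
    using assms conj_subgroup_conj_subgroup[of A h "inv h"]
      conj_subgroup_conj_subgroup[of A "inv h" h] conj_subgroup_one by auto
  with assms left show ?thesis
    by (simp add: normalizer_def stabilizer_def)
qed

definition conjugates_through :: "'a set \<Rightarrow> 'a \<Rightarrow> 'a set set" where
  "conjugates_through M g =
     {conj_subgroup G M x | x. x \<in> carrier G \<and> g \<in> conj_subgroup G M x}"

lemma conjugates_through_subset_carrier:
  "M \<subseteq> carrier G \<Longrightarrow> Q \<in> conjugates_through M g \<Longrightarrow> Q \<subseteq> carrier G"
  using conj_subgroup_subset_carrier by (auto simp: conjugates_through_def)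

lemma self_mem_conjugates_through:
  assumes "M \<subseteq> carrier G" "g \<in> M"
  shows "M \<in> conjugates_through M g"
  unfolding conjugates_through_def mem_Collect_eq
  using assms by (intro exI[of _ \<one>]) (simp add: conj_subgroup_one)

lemma finite_conjugates_through:
  "finite (carrier G) \<Longrightarrow> finite (conjugates_through M g)"
  by (simp add: conjugates_through_def)

lemma conj_image_conjugates_through:
  assumes M: "M \<subseteq> carrier G" and g: "g \<in> carrier G" and h: "h \<in> carrier G"
  shows "(\<lambda>Q. conj_subgroup G Q h) ` conjugates_through M g
       = conjugates_through M (inv h \<otimes> g \<otimes> h)"
proof -
  have mem: "inv h \<otimes> g \<otimes> h \<in> conj_subgroup G M (x \<otimes> h) \<longleftrightarrow> g \<in> conj_subgroup G M x"
    if x: "x \<in> carrier G" for x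
  proof -
    have "x \<otimes> h \<otimes> (inv h \<otimes> g \<otimes> h) \<otimes> inv (x \<otimes> h) = x \<otimes> g \<otimes> inv x"
      using g h x by (simp add: inv_mult_group m_assoc mult_inv_cancel_left)
    then show ?thesis
      using assms x by (simp add: mem_conj_subgroup_iff)
  qed
  show ?thesis
  proof (intro equalityI subsetI)
    fix Q assume "Q \<in> (\<lambda>Q. conj_subgroup G Q h) ` conjugates_through M g"
    then obtain x where "x \<in> carrier G" "g \<in> conj_subgroup G M x"
      "Q = conj_subgroup G M (x \<otimes> h)"
      using M h by (auto simp: conjugates_through_def conj_subgroup_conj_subgroup)
    with h mem show "Q \<in> conjugates_through M (inv h \<otimes> g \<otimes> h)"
      by (auto simp: conjugates_through_def)
  next
    \<comment> \<open>A conjugate by \<open>z\<close> arises by conjugating the one by \<open>z \<otimes> inv h\<close> with \<open>h\<close>.\<close>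
    fix Q assume "Q \<in> conjugates_through M (inv h \<otimes> g \<otimes> h)"
    then obtain z where z: "z \<in> carrier G" "inv h \<otimes> g \<otimes> h \<in> conj_subgroup G M z"
      and Q: "Q = conj_subgroup G M z"
      by (auto simp: conjugates_through_def)
    have zh: "z \<otimes> inv h \<in> carrier G" and eq: "z \<otimes> inv h \<otimes> h = z"
      using h z by (simp_all add: m_assoc)
    have "g \<in> conj_subgroup G M (z \<otimes> inv h)"
      using mem[OF zh] z(2) by (simp add: eq)
    moreover have "Q = conj_subgroup G (conj_subgroup G M (z \<otimes> inv h)) h"
      using conj_subgroup_conj_subgroup[OF M zh h] by (simp add: eq Q)
    ultimately show "Q \<in> (\<lambda>Q. conj_subgroup G Q h) ` conjugates_through M g"
      using zh by (auto simp: conjugates_through_def)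
  qed
qed

text \<open>The heart of the fusion argument. A conjugate of \<open>g\<close> in \<open>A\<close> lies in every conjugate of
  \<open>M\<close> through \<open>g\<close>, so these conjugates of \<open>M\<close> are among their own translates under conjugation
  by \<open>h\<close>. A finite set contained in an image of itself equals that image, so conjugation by \<open>h\<close>
  permutes them and fixes their intersection.\<close>

lemma normalizes_Inter_conjugates_through:
  assumes fin: "finite (carrier G)" and M: "M \<subseteq> carrier G" and g: "g \<in> M"
    and h: "h \<in> carrier G" and A: "A = \<Inter>(conjugates_through M g)"
    and hA: "inv h \<otimes> g \<otimes> h \<in> A"
  shows "h \<in> normalizer G A"
proof -
  let ?V = "conjugates_through M g" and ?c = "\<lambda>Q. conj_subgroup G Q h"
  have "M \<in> ?V"
    using M g by (rule self_mem_conjugates_through)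
  then have ne: "?V \<noteq> {}" and A_sub: "A \<subseteq> carrier G"
    using A M by auto
  have "?V \<subseteq> conjugates_through M (inv h \<otimes> g \<otimes> h)"
    using hA A by (auto simp: conjugates_through_def)
  then have sub: "?V \<subseteq> ?c ` ?V"
    using conj_image_conjugates_through[of M g h] M g h by auto
  have "?V = ?c ` ?V"
    using sub fin finite_conjugates_through by (intro card_seteq card_image_le) auto
  moreover have "conj_subgroup G A h = \<Inter>(?c ` ?V)"
    unfolding A using conjugates_through_subset_carrier[OF M] ne h
    by (intro conj_subgroup_Inter)
  ultimately have "conj_subgroup G A h = A"
    using A by simp
  then show ?thesis
    using mem_normalizer_iff_conj_subgroup A_sub h by simp
qed

lemma subgroup_centralizer:
  assumes g: "g \<in> carrier G"
  shows "subgroup (centralizer G g) G"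
proof (rule subgroupI)
  show "centralizer G g \<subseteq> carrier G" "centralizer G g \<noteq> {}"
    using g by (auto simp: centralizer_def intro!: exI[of _ \<one>])
  show "inv x \<in> centralizer G g" if "x \<in> centralizer G g" for x
  proof -
    have x: "x \<in> carrier G" "x \<otimes> g = g \<otimes> x"
      using that by (auto simp: centralizer_def)
    then have "inv x \<otimes> g = inv x \<otimes> (x \<otimes> g) \<otimes> inv x"
      using g by (simp add: m_assoc)
    also have "\<dots> = g \<otimes> inv x"
      using x(1) g by (simp add: mult_inv_cancel_left)
    finally show ?thesis
      using x(1) by (simp add: centralizer_def)
  qed
  show "x \<otimes> y \<in> centralizer G g" if "x \<in> centralizer G g" "y \<in> centralizer G g" for x y
  proof -
    have xy: "x \<in> carrier G" "x \<otimes> g = g \<otimes> x" "y \<in> carrier G" "y \<otimes> g = g \<otimes> y"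
      using that by (auto simp: centralizer_def)
    have "x \<otimes> y \<otimes> g = x \<otimes> g \<otimes> y"
      using xy(1,3,4) g by (simp add: m_assoc)
    also have "\<dots> = g \<otimes> (x \<otimes> y)"
      using xy g by (simp add: m_assoc)
    finally show ?thesis
      using xy by (simp add: centralizer_def)
  qed
qed

end

theorem theorem1p3:
  fixes G :: "('a, 'b) monoid_scheme" (structure)
    and M A S :: "'a set" and V :: "'a set set" and g :: 'a
  assumes "simple_group G" and "finite (carrier G)" and "\<not> comm_group G"
    and "maximal_subgroup M G"
    and "g \<in> M - {\<one>}"
    and "V = {conj_subgroup G M x | x. x \<in> carrier G \<and> g \<in> conj_subgroup G M x}"
    and "A = (\<Inter>Q\<in>V. Q)"
    and "S = normalizer G A"
  shows "subgroup (centralizer G g) (G\<lparr>carrier := S\<rparr>)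
       \<and> conj_class G S g = A \<inter> conj_class G (carrier G) g"
proof -
  interpret simple_group G by fact
  have M: "M \<subseteq> carrier G"
    using assms(4) subgroup.subset unfolding maximal_subgroup_def by blast
  have gM: "g \<in> M" and g: "g \<in> carrier G"
    using assms(5) M by auto
  have A: "A = \<Inter>(conjugates_through M g)"
    using assms(6,7) by (simp add: conjugates_through_def)
  have gA: "g \<in> A"
    unfolding A by (auto simp: conjugates_through_def)
  have "M \<in> conjugates_through M g"
    using M gM by (rule self_mem_conjugates_through)
  then have A_sub: "A \<subseteq> carrier G"
    using A M by auto
  have S: "subgroup S G"
    unfolding assms(8) using A_sub by (rule normalizer_imp_subgroup)
  have into_S: "h \<in> S" if "h \<in> carrier G" "inv h \<otimes> g \<otimes> h \<in> A" for h
    using normalizes_Inter_conjugates_through[OF assms(2) M gM that(1) A that(2)] assms(8)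
    by simp
  have "centralizer G g \<subseteq> S"
  proof
    fix h assume "h \<in> centralizer G g"
    then have h: "h \<in> carrier G" and comm: "h \<otimes> g = g \<otimes> h"
      by (auto simp: centralizer_def)
    have "inv h \<otimes> g \<otimes> h = g"
      using g h by (simp add: m_assoc mult_inv_cancel_left flip: comm)
    with h gA show "h \<in> S" by (simp add: into_S)
  qed
  then have "subgroup (centralizer G g) (G\<lparr>carrier := S\<rparr>)"
    by (intro subgroup_incl subgroup_centralizer g S)
  moreover have "conj_class G S g \<subseteq> A"
  proof
    fix y assume "y \<in> conj_class G S g"
    then obtain s where s: "s \<in> S" and y: "y = inv s \<otimes> g \<otimes> s"
      by (auto simp: conj_class_def)
    have "s \<in> carrier G"
      using s S subgroup.subset by blast
    then have "conj_subgroup G A s = A"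
      using s assms(8) A_sub mem_normalizer_iff_conj_subgroup by simp
    moreover have "y \<in> conj_subgroup G A s"
      using gA y by (auto simp: conj_subgroup_def l_coset_def r_coset_def)
    ultimately show "y \<in> A" by simp
  qed
  then have "conj_class G S g = A \<inter> conj_class G (carrier G) g"
    using into_S subgroup.subset[OF S] by (auto simp: conj_class_def)
  ultimately show ?thesis ..
qed

end
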